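(* Let $p$ and $q$ be pure unit quaternions (pure quaternions of norm $1$). Then for every integer $k\ge 1$ and any real numbers $s_1,\dots,s_k$ and $t_1,\dots,t_k$, $$\mathrm{Tr}\left(\prod_{i=1}^k\phi_p(s_i)\phi_q(t_i)\right)=\mathrm{Tr}\left(\prod_{i=1}^k\phi_q(s_i)\phi_p(t_i)\right).$$
   Context: $\mathbb{H}$ is the division ring of real quaternions. A quaternion is pure if its real part is zero. For a pure quaternion $p$ and $s\in\mathbb{R}$, $\phi_p(s)=e^{sp}=\sum_{i\ge0}\frac{1}{i!}s^ip^i$. For $x\in\mathbb{H}$, $\mathrm{Tr}(x)=x+\bar x=2\,\mathrm{Re}(x)$. Products are ordered: $\prod_{i=1}^k x_i=x_1x_2\cdots x_k$. *)

theory Defs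
  imports Complex_Main
begin

text \<open>
  The element \<open>Quat a b c d\<close> stands for \<open>a + b i + c j + d k\<close>, with Hamilton's
  multiplication rules \<open>i\<^sup>2 = j\<^sup>2 = k\<^sup>2 = -1\<close> and \<open>i j = k\<close>.
  As for \<^typ>\<open>complex\<close>, a codatatype is used so that \<open>primcorec\<close> is available.
\<close>

codatatype quat = Quat (qRe: real) (qI: real) (qJ: real) (qK: real)

lemma quat_eq_iff: "x = y \<longleftrightarrow> qRe x = qRe y \<and> qI x = qI y \<and> qJ x = qJ y \<and> qK x = qK y"
  by (auto intro: quat.expand)

instantiation quat :: ab_group_add
begin

primcorec zero_quat where
  "qRe 0 = 0"
| "qI 0 = 0"
| "qJ 0 = 0"
| "qK 0 = 0"

primcorec plus_quat where
  "qRe (x + y) = qRe x + qRe y"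
| "qI (x + y) = qI x + qI y"
| "qJ (x + y) = qJ x + qJ y"
| "qK (x + y) = qK x + qK y"

primcorec uminus_quat where
  "qRe (- x) = - qRe x"
| "qI (- x) = - qI x"
| "qJ (- x) = - qJ x"
| "qK (- x) = - qK x"

primcorec minus_quat where
  "qRe (x - y) = qRe x - qRe y"
| "qI (x - y) = qI x - qI y"
| "qJ (x - y) = qJ x - qJ y"
| "qK (x - y) = qK x - qK y"

instance
  by standard (simp_all add: quat_eq_iff)

end

instantiation quat :: ring_1
begin

primcorec one_quat where
  "qRe 1 = 1"
| "qI 1 = 0"
| "qJ 1 = 0"
| "qK 1 = 0"

primcorec times_quat where
  "qRe (x * y) = qRe x * qRe y - qI x * qI y - qJ x * qJ y - qK x * qK y"
| "qI (x * y) = qRe x * qI y + qI x * qRe y + qJ x * qK y - qK x * qJ y"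
| "qJ (x * y) = qRe x * qJ y - qI x * qK y + qJ x * qRe y + qK x * qI y"
| "qK (x * y) = qRe x * qK y + qI x * qJ y - qJ x * qI y + qK x * qRe y"

instance
  by standard (simp_all add: quat_eq_iff algebra_simps)

end

instantiation quat :: real_algebra_1
begin

primcorec scaleR_quat where
  "qRe (scaleR r x) = r * qRe x"
| "qI (scaleR r x) = r * qI x"
| "qJ (scaleR r x) = r * qJ x"
| "qK (scaleR r x) = r * qK x"

instance
  by standard (simp_all add: quat_eq_iff algebra_simps)

end

primcorec qcnj :: "quat \<Rightarrow> quat" where
  "qRe (qcnj x) = qRe x"
| "qI (qcnj x) = - qI x"
| "qJ (qcnj x) = - qJ x"
| "qK (qcnj x) = - qK x"

abbreviation qnorm2 :: "quat \<Rightarrow> real" where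
  "qnorm2 x \<equiv> (qRe x)\<^sup>2 + (qI x)\<^sup>2 + (qJ x)\<^sup>2 + (qK x)\<^sup>2"

lemma qnorm2_eq_0_iff: "qnorm2 x = 0 \<longleftrightarrow> x = 0"
  by (auto simp: quat_eq_iff add_nonneg_eq_0_iff)

lemma qnorm2_mult: "qnorm2 (x * y) = qnorm2 x * qnorm2 y"
  by (simp add: power2_eq_square algebra_simps)

lemma mult_qcnj: "x * qcnj x = of_real (qnorm2 x)" "qcnj x * x = of_real (qnorm2 x)"
  by (simp_all add: of_real_def quat_eq_iff power2_eq_square algebra_simps)

instantiation quat :: real_div_algebra
begin

definition inverse_quat :: "quat \<Rightarrow> quat" where
  "inverse x = qcnj x /\<^sub>R qnorm2 x"

definition divide_quat :: "quat \<Rightarrow> quat \<Rightarrow> quat" where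
  "x div y = x * inverse (y :: quat)"

instance
proof
  fix x y :: quat
  show "inverse x * x = 1" "x * inverse x = 1" if "x \<noteq> 0"
    using that qnorm2_eq_0_iff[of x] by (simp_all add: inverse_quat_def mult_qcnj of_real_def)
  show "x div y = x * inverse y"
    by (rule divide_quat_def)
  show "inverse (0 :: quat) = 0"
    by (simp add: inverse_quat_def quat_eq_iff)
qed

end

instantiation quat :: real_normed_div_algebra
begin

definition norm_quat :: "quat \<Rightarrow> real" where
  "norm x = sqrt ((qRe x)\<^sup>2 + (qI x)\<^sup>2 + (qJ x)\<^sup>2 + (qK x)\<^sup>2)"

definition sgn_quat :: "quat \<Rightarrow> quat" where
  "sgn x = (x :: quat) /\<^sub>R norm x"

definition dist_quat :: "quat \<Rightarrow> quat \<Rightarrow> real" where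
  "dist x y = norm (x - y :: quat)"

definition uniformity_quat :: "(quat \<times> quat) filter" where
  "uniformity_quat = (INF e\<in>{0 <..}. principal {(x, y). dist x y < e})"

definition open_quat :: "quat set \<Rightarrow> bool" where
  "open_quat U \<longleftrightarrow> (\<forall>x\<in>U. eventually (\<lambda>(x', y). x' = x \<longrightarrow> y \<in> U) uniformity)"

instance
proof
  fix r :: real and x y :: quat and U :: "quat set"
  show "sgn x = x /\<^sub>R norm x"
    by (rule sgn_quat_def)
  show "dist x y = norm (x - y)"
    by (rule dist_quat_def)
  show "(uniformity :: (quat \<times> quat) filter) = (INF e\<in>{0 <..}. principal {(x, y). dist x y < e})"
    by (rule uniformity_quat_def)
  show "open U \<longleftrightarrow> (\<forall>x\<in>U. eventually (\<lambda>(x', y). x' = x \<longrightarrow> y \<in> U) uniformity)"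
    by (rule open_quat_def)
  show "norm x = 0 \<longleftrightarrow> x = 0"
    by (simp add: norm_quat_def qnorm2_eq_0_iff)
  show "norm (r *\<^sub>R x) = \<bar>r\<bar> * norm x"
    by (simp add: norm_quat_def power_mult_distrib distrib_left [symmetric] real_sqrt_mult)
  show mult: "norm (x * y) = norm x * norm y" for x y :: quat
    by (simp only: norm_quat_def qnorm2_mult real_sqrt_mult)
  have cnj: "norm (qcnj x) = norm x" for x
    by (simp add: norm_quat_def)
  have nonneg: "norm x \<ge> 0" for x :: quat
    by (simp add: norm_quat_def)
  have sq: "(norm x)\<^sup>2 = qnorm2 x" for x :: quat
    by (simp add: norm_quat_def)
  have "qRe (x * qcnj y) \<le> norm (x * qcnj y)"
    unfolding norm_quat_def by (rule real_le_rsqrt) simp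
  then have "qRe (x * qcnj y) \<le> norm x * norm y"
    by (simp only: mult cnj)
  moreover have "(norm (x + y))\<^sup>2 = (norm x)\<^sup>2 + 2 * qRe (x * qcnj y) + (norm y)\<^sup>2"
    unfolding sq by (simp add: power2_eq_square algebra_simps)
  ultimately have "(norm (x + y))\<^sup>2 \<le> (norm x + norm y)\<^sup>2"
    by (simp add: power2_sum)
  then show "norm (x + y) \<le> norm x + norm y"
    by (rule power2_le_imp_le) (simp add: nonneg)
qed

end

lemma bounded_linear_quat_sel:
  "bounded_linear qRe" "bounded_linear qI" "bounded_linear qJ" "bounded_linear qK"
  by (rule bounded_linear_intro[where K = 1];
      simp add: norm_quat_def; rule real_le_rsqrt; simp)+

lemma tendsto_Quat:
  assumes "(a \<longlongrightarrow> a') F" "(b \<longlongrightarrow> b') F" "(c \<longlongrightarrow> c') F" "(d \<longlongrightarrow> d') F"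
  shows "((\<lambda>x. Quat (a x) (b x) (c x) (d x)) \<longlongrightarrow> Quat a' b' c' d') F"
proof -
  have "((\<lambda>x. sqrt ((a x - a')\<^sup>2 + (b x - b')\<^sup>2 + (c x - c')\<^sup>2 + (d x - d')\<^sup>2)) \<longlongrightarrow>
          sqrt ((a' - a')\<^sup>2 + (b' - b')\<^sup>2 + (c' - c')\<^sup>2 + (d' - d')\<^sup>2)) F"
    by (intro tendsto_intros assms)
  then show ?thesis
    by (subst tendsto_dist_iff) (simp add: dist_quat_def norm_quat_def)
qed

instance quat :: banach
proof
  fix X :: "nat \<Rightarrow> quat"
  assume "Cauchy X"
  then have "convergent (\<lambda>n. qRe (X n))" "convergent (\<lambda>n. qI (X n))"
    "convergent (\<lambda>n. qJ (X n))" "convergent (\<lambda>n. qK (X n))"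
    by (auto intro: Cauchy_convergent bounded_linear.Cauchy bounded_linear_quat_sel)
  then obtain a b c d where "(\<lambda>n. qRe (X n)) \<longlonglongrightarrow> a" "(\<lambda>n. qI (X n)) \<longlonglongrightarrow> b"
    "(\<lambda>n. qJ (X n)) \<longlonglongrightarrow> c" "(\<lambda>n. qK (X n)) \<longlonglongrightarrow> d"
    by (auto simp: convergent_def)
  then have "(\<lambda>n. Quat (qRe (X n)) (qI (X n)) (qJ (X n)) (qK (X n))) \<longlonglongrightarrow> Quat a b c d"
    by (rule tendsto_Quat)
  then show "convergent X"
    unfolding quat.collapse by (rule convergentI)
qed

definition pure_quat :: "quat \<Rightarrow> bool" where
  "pure_quat x \<longleftrightarrow> qRe x = 0"

text \<open>
  The trace is valued in the quaternions, in the real line spanned by \<open>1\<close>.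
\<close>

definition qTr :: "quat \<Rightarrow> quat" where
  "qTr x = x + qcnj x"

lemma qTr_eq: "qTr x = of_real (2 * qRe x)"
  by (simp add: qTr_def of_real_def quat_eq_iff)

definition phi :: "quat \<Rightarrow> real \<Rightarrow> quat" where
  "phi p s = exp (s *\<^sub>R p)"

lemma phi_sums: "(\<lambda>i. (s ^ i / fact i) *\<^sub>R p ^ i) sums phi p s"
  using exp_converges[of "s *\<^sub>R p"] by (simp add: phi_def divide_inverse mult.commute)

text \<open>
  The big operator \<open>\<Prod>\<close> requires a commutative multiplication, so ordered products are
  products of lists.
\<close>

definition ordered_prod :: "nat \<Rightarrow> (nat \<Rightarrow> 'a) \<Rightarrow> 'a :: monoid_mult" where
  "ordered_prod k x = prod_list (map x [1..<Suc k])"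

end

theory Submission
  imports Defs
begin

text \<open>
  Some nonzero quaternion \<open>u\<close> satisfies \<open>p u = u q\<close> and \<open>q u = u p\<close>: since \<open>p\<^sup>2 = q\<^sup>2 = -1\<close>, one may
  take \<open>u = p + q\<close>, or, if \<open>q = -p\<close>, any nonzero pure quaternion orthogonal to \<open>p\<close>. Conjugation
  by \<open>u\<close> therefore exchanges \<open>phi p\<close> and \<open>phi q\<close>, hence the two products, and it preserves the trace.
\<close>

lemma pure_unit_quat_square:
  assumes "pure_quat p" "norm p = 1"
  shows "p * p = - 1"
proof -
  have "(qI p)\<^sup>2 + (qJ p)\<^sup>2 + (qK p)\<^sup>2 = 1"
    using assms by (simp add: norm_quat_def pure_quat_def)
  with assms(1) show ?thesis
    by (simp add: quat_eq_iff pure_quat_def power2_eq_square algebra_simps)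
qed

lemma pure_quat_anticommuting:
  assumes "pure_quat p"
  obtains u where "u \<noteq> 0" "p * u = - (u * p)"
proof (cases "qI p = 0 \<and> qJ p = 0")
  case True
  \<comment> \<open>Here \<open>p\<close> is a real multiple of the unit k, which anticommutes with
    i.\<close>
  show ?thesis
    by (rule that[of "Quat 0 1 0 0"])
      (use True assms in \<open>simp_all add: quat_eq_iff pure_quat_def\<close>)
next
  case False
  \<comment> \<open>The witness is a quarter turn of the (i, j)-part of \<open>p\<close>, so it is
    orthogonal to \<open>p\<close>; orthogonal pure quaternions anticommute.\<close>
  show ?thesis
    by (rule that[of "Quat 0 (- qJ p) (qI p) 0"])
      (use False assms in \<open>auto simp add: quat_eq_iff pure_quat_def\<close>)
qed

lemma pure_unit_quat_swap:
  assumes "pure_quat p" "norm p = 1" "pure_quat q" "norm q = 1"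
  obtains u where "u \<noteq> 0" "p * u = u * q" "q * u = u * p"
proof (cases "p + q = 0")
  case True
  then have q: "q = - p"
    by (simp add: add_eq_0_iff)
  obtain u where "u \<noteq> 0" "p * u = - (u * p)"
    using pure_quat_anticommuting[OF assms(1)] .
  then show ?thesis
    by (intro that[of u]) (simp_all add: q)
next
  case False
  \<comment> \<open>With \<open>u = p + q\<close>, both sides of the first equation are
    \<open>p * q - 1\<close>, and both sides of the second are \<open>q * p - 1\<close>.\<close>
  show ?thesis
    by (rule that[OF False])
      (simp_all add: pure_unit_quat_square assms distrib_left distrib_right add.commute)
qed

lemma power_intertwine:
  fixes p q u :: "'a :: monoid_mult"
  assumes "p * u = u * q"
  shows "p ^ n * u = u * q ^ n"
proof (induction n)
  case (Suc n)
  have "p ^ Suc n * u = p * (p ^ n * u)"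
    by (simp add: mult.assoc)
  also have "\<dots> = (p * u) * q ^ n"
    by (simp add: Suc mult.assoc)
  finally show ?case
    by (simp add: assms mult.assoc)
qed simp

text \<open>The relation passes to all powers, hence to the exponential series term by term, since
  multiplication by \<open>u\<close> is linear and continuous.\<close>

lemma phi_intertwine:
  assumes "p * u = u * q"
  shows "phi p s * u = u * phi q s"
proof -
  have "(\<lambda>i. (s ^ i / fact i) *\<^sub>R p ^ i * u) sums (phi p s * u)"
    by (rule sums_mult2[OF phi_sums])
  moreover have "(\<lambda>i. u * ((s ^ i / fact i) *\<^sub>R q ^ i)) sums (u * phi q s)"
    by (rule sums_mult[OF phi_sums])
  ultimately show ?thesis
    by (simp add: power_intertwine[OF assms] sums_unique2)
qed

lemma prod_list_intertwine:
  fixes u :: "'a :: monoid_mult"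
  assumes "\<And>i. x i * u = u * y i"
  shows "prod_list (map x xs) * u = u * prod_list (map y xs)"
proof (induction xs)
  case (Cons i xs)
  have "prod_list (map x (i # xs)) * u = (x i * u) * prod_list (map y xs)"
    by (simp add: Cons mult.assoc)
  then show ?case
    by (simp add: assms mult.assoc)
qed simp

text \<open>Swapping the factors only flips the cross product of the imaginary parts, which the
  trace does not see.\<close>

lemma qTr_mult_commute: "qTr (x * y) = qTr (y * x)"
  by (simp add: qTr_eq algebra_simps)

lemma qTr_intertwine:
  assumes "u \<noteq> 0" "x * u = u * y"
  shows "qTr x = qTr y"
proof -
  have "x = (x * u) * inverse u"
    using assms(1) by (simp add: mult.assoc)
  then have "qTr x = qTr (u * (y * inverse u))"
    by (simp add: assms(2) mult.assoc)
  also have "\<dots> = qTr ((y * inverse u) * u)"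
    by (rule qTr_mult_commute)
  finally show ?thesis
    using assms(1) by (simp add: mult.assoc)
qed

theorem theorem4p1:
  fixes p q :: quat and k :: nat and s t :: "nat \<Rightarrow> real"
  assumes "pure_quat p" "norm p = 1"
    and "pure_quat q" "norm q = 1"
    and "k \<ge> 1"
  shows "qTr (ordered_prod k (\<lambda>i. phi p (s i) * phi q (t i))) =
    qTr (ordered_prod k (\<lambda>i. phi q (s i) * phi p (t i)))"
proof -
  obtain u where "u \<noteq> 0" and pq: "p * u = u * q" and qp: "q * u = u * p"
    using pure_unit_quat_swap[OF assms(1-4)] .
  \<comment> \<open>Moving left, \<open>u\<close> passes \<open>phi q (t i)\<close> by
    \<open>qp\<close> and then \<open>phi p (s i)\<close> by \<open>pq\<close>.\<close>
  have "phi p (s i) * phi q (t i) * u = u * (phi q (s i) * phi p (t i))" for i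
    by (metis phi_intertwine[OF pq] phi_intertwine[OF qp] mult.assoc)
  then have "ordered_prod k (\<lambda>i. phi p (s i) * phi q (t i)) * u =
      u * ordered_prod k (\<lambda>i. phi q (s i) * phi p (t i))"
    unfolding ordered_prod_def by (rule prod_list_intertwine)
  with \<open>u \<noteq> 0\<close> show ?thesis
    by (rule qTr_intertwine)
qed

end
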